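(* Geodesic spheres in $G_{1/2}$ are always topological spheres: for every $r>0$, the set of points of $G_{1/2}$ at Riemannian distance $r$ from the identity is homeomorphic to the $2$-sphere.
   Context: $G_{1/2}$ is $\mathbb{R}^3$ with group law $(x,y,z)\ast(x',y',z')=(x'e^z+x,\;y'e^{-z/2}+y,\;z'+z)$ and the left-invariant Riemannian metric $ds^2=e^{-2z}dx^2+e^{z}dy^2+dz^2$; the identity is the origin $(0,0,0)$. By homogeneity, the statement for spheres centered at the identity gives it for all centers. *)

theory Defs
  imports "HOL-Analysis.Analysis"
begin

section \<open>Riemannian distance on a Euclidean space with a given metric tensor\<close>

definition riemannian_speed ::
  "('a::euclidean_space \<Rightarrow> 'a \<Rightarrow> 'a \<Rightarrow> real) \<Rightarrow> (real \<Rightarrow> 'a) \<Rightarrow> real \<Rightarrow> real" where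
  "riemannian_speed g c t =
     sqrt (g (c t) (vector_derivative c (at t)) (vector_derivative c (at t)))"

definition riemannian_length ::
  "('a::euclidean_space \<Rightarrow> 'a \<Rightarrow> 'a \<Rightarrow> real) \<Rightarrow> (real \<Rightarrow> 'a) \<Rightarrow> real" where
  "riemannian_length g c = integral {0..1} (riemannian_speed g c)"

text \<open>
  A \<^const>\<open>valid_path\<close> is continuous and piecewise $C^1$, but its derivative may be unbounded
  near the finitely many exceptional points, so that its length may be infinite. Since
  \<^const>\<open>integral\<close> is 0 on non-integrable functions, such paths must be excluded explicitly.
\<close>

definition riemannian_dist ::
  "('a::euclidean_space \<Rightarrow> 'a \<Rightarrow> 'a \<Rightarrow> real) \<Rightarrow> 'a \<Rightarrow> 'a \<Rightarrow> real" where
  "riemannian_dist g p q =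
     Inf {riemannian_length g c | c.
            valid_path c \<and> pathstart c = p \<and> pathfinish c = q \<and>
            riemannian_speed g c integrable_on {0..1}}"

definition riemannian_sphere ::
  "('a::euclidean_space \<Rightarrow> 'a \<Rightarrow> 'a \<Rightarrow> real) \<Rightarrow> 'a \<Rightarrow> real \<Rightarrow> 'a set" where
  "riemannian_sphere g p r = {q. riemannian_dist g p q = r}"


section \<open>The Lie group $G_{1/2}$\<close>

definition G_mult :: "real^3 \<Rightarrow> real^3 \<Rightarrow> real^3" where
  "G_mult p q = vector [q$1 * exp (p$3) + p$1, q$2 * exp (- (p$3) / 2) + p$2, q$3 + p$3]"

definition G_one :: "real^3" where
  "G_one = 0"

definition G_metric :: "real^3 \<Rightarrow> real^3 \<Rightarrow> real^3 \<Rightarrow> real" where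
  "G_metric p v w =
     exp (- 2 * p$3) * (v$1 * w$1) + exp (p$3) * (v$2 * w$2) + v$3 * w$3"

lemma G_mult_assoc: "G_mult (G_mult p q) s = G_mult p (G_mult q s)"
proof -
  have "exp (- (q$3 + p$3) / 2) = exp (- (q$3) / 2) * exp (- (p$3) / 2)"
    by (simp add: exp_add [symmetric] field_simps)
  then show ?thesis
    by (simp add: G_mult_def vec_eq_iff forall_3 vector_3 exp_add distrib_right mult.assoc)
qed

lemma G_mult_one: "G_mult G_one p = p" "G_mult p G_one = p"
  by (simp_all add: G_mult_def G_one_def vec_eq_iff forall_3 vector_3)

lemma G_mult_left_inverse: "\<exists>q. G_mult q p = G_one"
proof
  show "G_mult (vector [- (p$1) * exp (- (p$3)), - (p$2) * exp (p$3 / 2), - (p$3)]) p = G_one"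
    by (simp add: G_mult_def G_one_def vec_eq_iff forall_3 vector_3)
qed

lemma G_mult_has_derivative:
  "(G_mult p has_derivative
     (\<lambda>v. vector [v$1 * exp (p$3), v$2 * exp (- (p$3) / 2), v$3])) (at q)"
proof -
  have v: "vector [a, b, c] = a *\<^sub>R axis 1 1 + b *\<^sub>R axis 2 1 + c *\<^sub>R (axis 3 1 :: real^3)"
    for a b c :: real
    by (simp add: vec_eq_iff forall_3 vector_3 axis_def)
  show ?thesis
    unfolding G_mult_def v
    by (auto intro!: derivative_eq_intros bounded_linear.has_derivative [OF bounded_linear_vec_nth])
qed

lemma G_metric_left_invariant:
  assumes "(G_mult p has_derivative D) (at q)"
  shows "G_metric (G_mult p q) (D v) (D w) = G_metric q v w"
proof -
  have "D = (\<lambda>v. vector [v$1 * exp (p$3), v$2 * exp (- (p$3) / 2), v$3])"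
    using assms G_mult_has_derivative by (rule has_derivative_unique)
  moreover have "exp (- 2 * (q$3 + p$3)) * (exp (p$3) * exp (p$3)) = exp (- 2 * q$3)"
    by (simp add: exp_add [symmetric])
  moreover have "exp (q$3 + p$3) * (exp (- (p$3) / 2) * exp (- (p$3) / 2)) = exp (q$3)"
    by (simp add: exp_add [symmetric])
  moreover have "E * ((a * P) * (b * P)) = (E * (P * P)) * (a * b)" for E P a b :: real
    by (simp only: mult_ac)
  ultimately show ?thesis
    unfolding G_metric_def G_mult_def by (simp only: vector_3)
qed

end

(*
  The automorphism (x, y, z) |-> (k x, k y, z) of G_{1/2} with 0 <= k < 1 shortens curves, and by
  a definite amount if the endpoint is off the z-axis. Hence the distance to the identity is
  strictly increasing along horizontal rays t |-> (t x, t y, z), starting at the value |z| on the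
  axis and tending to infinity. So the sphere of radius r meets each such ray with |z| < r
  exactly once, and at |z| = r only on the axis. Rescaling the horizontal part of a point
  to norm sqrt (1 - z^2 / r^2), and z to z / r, is therefore a continuous bijection from the
  (compact) geodesic sphere onto the Euclidean unit sphere.
*)

theory Submission
  imports Defs
begin

section \<open>Splitting into horizontal and vertical parts\<close>

definition horizontal :: "real^3 \<Rightarrow> real^3" where
  "horizontal p = vector [p$1, p$2, 0]"

definition vertical :: "real^3 \<Rightarrow> real^3" where
  "vertical p = vector [0, 0, p$3]"

definition scale_horizontal :: "real \<Rightarrow> real^3 \<Rightarrow> real^3" where
  "scale_horizontal k p = k *\<^sub>R horizontal p + vertical p"

lemma horizontal_nth [simp]:
  "horizontal p $ 1 = p$1" "horizontal p $ 2 = p$2" "horizontal p $ 3 = 0"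
  by (simp_all add: horizontal_def)

lemma vertical_nth [simp]: "vertical p $ 1 = 0" "vertical p $ 2 = 0" "vertical p $ 3 = p$3"
  by (simp_all add: vertical_def)

lemma scale_horizontal_nth [simp]:
  "scale_horizontal k p $ 1 = k * p$1" "scale_horizontal k p $ 2 = k * p$2"
  "scale_horizontal k p $ 3 = p$3"
  by (simp_all add: scale_horizontal_def)

lemma norm_3: "norm v = sqrt ((v$1)\<^sup>2 + (v$2)\<^sup>2 + (v$3)\<^sup>2)" for v :: "real^3"
  by (simp add: norm_vec_def L2_set_def sum_3)

lemma inner_3: "v \<bullet> w = v$1 * w$1 + v$2 * w$2 + v$3 * w$3" for v w :: "real^3"
  by (simp add: inner_vec_def sum_3)

lemma bounded_linear_horizontal: "bounded_linear horizontal"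
  by (intro linear_conv_bounded_linear[THEN iffD1] linearI) (simp_all add: vec_eq_iff forall_3)

lemma bounded_linear_vertical: "bounded_linear vertical"
  by (intro linear_conv_bounded_linear[THEN iffD1] linearI) (simp_all add: vec_eq_iff forall_3)

lemma bounded_linear_scale_horizontal: "bounded_linear (scale_horizontal k)"
  by (intro linear_conv_bounded_linear[THEN iffD1] linearI)
    (simp_all add: vec_eq_iff forall_3 algebra_simps)

lemma horizontal_vertical: "horizontal p + vertical p = p"
  by (simp add: vec_eq_iff forall_3)

lemma norm_horizontal_vertical:
  "(norm (a *\<^sub>R horizontal p + b *\<^sub>R vertical q))\<^sup>2 = (a * norm (horizontal p))\<^sup>2 + (b * q$3)\<^sup>2"
  by (simp add: norm_3 power_mult_distrib distrib_left)

lemma horizontal_eq_0_iff: "horizontal p = 0 \<longleftrightarrow> p = vertical p"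
  by (auto simp: vec_eq_iff forall_3)

section \<open>The Riemannian norm of tangent vectors\<close>

definition G_norm :: "real^3 \<Rightarrow> real^3 \<Rightarrow> real" where
  "G_norm q v = sqrt (G_metric q v v)"

lemma G_norm_alt: "G_norm q v = sqrt (exp (- 2 * q$3) * (v$1)\<^sup>2 + exp (q$3) * (v$2)\<^sup>2 + (v$3)\<^sup>2)"
  by (simp add: G_norm_def G_metric_def power2_eq_square)

text \<open>These are the coordinates of \<open>v\<close> in the left-invariant orthonormal frame at
  \<open>q\<close>, so norm properties such as the triangle inequality carry over from Euclidean
  space.\<close>

lemma G_norm_frame: "G_norm q v = norm (vector [exp (- q$3) * v$1, exp (q$3 / 2) * v$2, v$3] :: real^3)"
proof -
  have "(exp (- q$3))\<^sup>2 = exp (- 2 * q$3)" "(exp (q$3 / 2))\<^sup>2 = exp (q$3)"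
    by (simp_all add: exp_double [symmetric])
  then show ?thesis
    by (simp add: G_norm_alt norm_3 power_mult_distrib)
qed

lemma G_norm_nonneg [simp]: "0 \<le> G_norm q v"
  by (simp add: G_norm_frame)

lemma G_norm_power2: "(G_norm q v)\<^sup>2 = exp (- 2 * q$3) * (v$1)\<^sup>2 + exp (q$3) * (v$2)\<^sup>2 + (v$3)\<^sup>2"
  unfolding G_norm_alt by (simp add: add_nonneg_nonneg)

lemma G_norm_triangle: "G_norm q (v + w) \<le> G_norm q v + G_norm q w"
proof -
  have "vector [exp (- q$3) * (v + w)$1, exp (q$3 / 2) * (v + w)$2, (v + w)$3]
      = vector [exp (- q$3) * v$1, exp (q$3 / 2) * v$2, v$3]
        + (vector [exp (- q$3) * w$1, exp (q$3 / 2) * w$2, w$3] :: real^3)"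
    by (simp add: vec_eq_iff forall_3 algebra_simps)
  then show ?thesis
    unfolding G_norm_frame by (metis norm_triangle_ineq)
qed

text \<open>The metric depends on the base point only through its height; a height change of at most
  \<open>h\<close> multiplies each squared coefficient by at most
  \<open>exp (2 * h)\<close>.\<close>

lemma G_norm_change_base:
  assumes "\<bar>q'$3 - q$3\<bar> \<le> h"
  shows "G_norm q' v \<le> exp h * G_norm q v"
proof (rule power2_le_imp_le)
  have h0: "0 \<le> h" using assms by linarith
  have e: "(exp h)\<^sup>2 = exp (2 * h)" by (simp add: exp_double)
  have "exp (- 2 * q'$3) \<le> exp (2 * h) * exp (- 2 * q$3)"
    unfolding exp_add [symmetric] exp_le_cancel_iff using assms by linarith
  moreover have "exp (q'$3) \<le> exp (2 * h) * exp (q$3)"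
    unfolding exp_add [symmetric] exp_le_cancel_iff using assms by linarith
  moreover have "1 \<le> exp (2 * h)" using h0 by simp
  ultimately have "exp (- 2 * q'$3) * (v$1)\<^sup>2 + exp (q'$3) * (v$2)\<^sup>2 + 1 * (v$3)\<^sup>2
      \<le> (exp (2 * h) * exp (- 2 * q$3)) * (v$1)\<^sup>2 + (exp (2 * h) * exp (q$3)) * (v$2)\<^sup>2
        + exp (2 * h) * (v$3)\<^sup>2"
    by (intro add_mono mult_right_mono) auto
  then show "(G_norm q' v)\<^sup>2 \<le> (exp h * G_norm q v)\<^sup>2"
    unfolding power_mult_distrib G_norm_power2 e by (simp add: algebra_simps)
qed simp

text \<open>Changing the base point to or from height 0 then compares the Riemannian and Euclidean
  norms on any slab of bounded height.\<close>

lemma G_norm_at_vertical_0: "q$3 = 0 \<Longrightarrow> G_norm q v = norm v"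
  by (simp add: G_norm_alt norm_3)

lemma G_norm_le_norm: "\<bar>q$3\<bar> \<le> h \<Longrightarrow> G_norm q v \<le> exp h * norm v"
  using G_norm_change_base [of q 0 h v] by (simp add: G_norm_at_vertical_0)

lemma norm_le_G_norm:
  assumes "\<bar>q$3\<bar> \<le> h"
  shows "exp (- h) * norm v \<le> G_norm q v"
proof -
  have "norm v \<le> exp h * G_norm q v"
    using G_norm_change_base [of 0 q h v] assms by (simp add: G_norm_at_vertical_0)
  then show ?thesis
    by (simp add: exp_minus field_simps)
qed

lemma abs_nth_3_le_G_norm: "\<bar>v$3\<bar> \<le> G_norm q v"
  by (rule power2_le_imp_le) (simp_all add: G_norm_power2)

lemma continuous_on_G_norm:
  assumes "continuous_on A c" "continuous_on A D"
  shows "continuous_on A (\<lambda>t. G_norm (c t) (D t))"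
  unfolding G_norm_alt by (intro continuous_intros assms)

lemma G_norm_scale_horizontal_power2:
  "(G_norm (scale_horizontal k q) (scale_horizontal k v))\<^sup>2
     = (G_norm q v)\<^sup>2 - (1 - k\<^sup>2) * (G_norm q (horizontal v))\<^sup>2"
  by (simp add: G_norm_power2 power_mult_distrib algebra_simps)

text \<open>
  With $s$ the speed and $A$ the squared horizontal speed, $A / s \ge 2 a u - a^2 s$ if
  $u^2 \le A$. The right-hand side is linear in $s$ and $u$, so it can be integrated along a curve.
\<close>

lemma G_norm_scale_horizontal_le:
  assumes k: "0 \<le> k" "k < 1" and u: "\<bar>u\<bar> \<le> G_norm q (horizontal v)"
  shows "G_norm (scale_horizontal k q) (scale_horizontal k v)
    \<le> G_norm q v - (1 - k\<^sup>2) / 2 * (2 * a * u - a\<^sup>2 * G_norm q v)"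
proof -
  define s A b where "s = G_norm q v" and "A = (G_norm q (horizontal v))\<^sup>2" and "b = (1 - k\<^sup>2) / 2"
  have k2: "k\<^sup>2 < 1" "0 \<le> k\<^sup>2" using k by (simp_all add: power_less_one_iff)
  have b: "0 < b" "b \<le> 1/2" using k2 by (auto simp: b_def)
  have As: "A \<le> s\<^sup>2" by (simp add: A_def s_def G_norm_power2)
  have uA: "u\<^sup>2 \<le> A" unfolding A_def using u by (metis abs_ge_zero power2_abs power_mono)
  have s0: "0 \<le> s" by (simp add: s_def)
  have sk: "(G_norm (scale_horizontal k q) (scale_horizontal k v))\<^sup>2 = s\<^sup>2 - 2 * b * A"
    by (simp add: G_norm_scale_horizontal_power2 s_def A_def b_def)
  show ?thesis
  \<comment> \<open>The argument divides by the speed \<open>s\<close>; where \<open>s\<close>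
    vanishes, \<open>A\<close> and \<open>u\<close> vanish as well and both sides are 0.\<close>
  proof (cases "s = 0")
    case True
    then have "A = 0" using As by (simp add: A_def)
    moreover from this have "u = 0" using uA by simp
    ultimately show ?thesis using True sk by (simp add: s_def)
  next
    case False
    with s0 have s: "0 < s" by simp
    have bA: "b * A \<le> 1 * s\<^sup>2" using As b by (intro mult_mono) (auto simp: A_def)
    \<comment> \<open>The square root of \<open>s^2 - 2 * b * A\<close> lies below its linearisation
      \<open>s - b * A / s\<close>, whose square has the extra term
      \<open>(b * A / s)^2\<close>.\<close>
    have "(G_norm (scale_horizontal k q) (scale_horizontal k v))\<^sup>2 \<le> (s - b * A / s)\<^sup>2"
      unfolding sk using s by (simp add: power2_diff power_divide)
    moreover have "0 \<le> s - b * A / s"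
      using bA s by (simp add: field_simps power2_eq_square)
    ultimately have "G_norm (scale_horizontal k q) (scale_horizontal k v) \<le> s - b * (A / s)"
      by (metis power2_le_imp_le times_divide_eq_right)
    moreover have "2 * a * u - a\<^sup>2 * s \<le> A / s"
    proof -
      have "2 * a * u * s - a\<^sup>2 * s * s \<le> u\<^sup>2"
        using zero_le_power2 [of "u - a * s"] by (simp add: power2_eq_square algebra_simps)
      also have "\<dots> \<le> A" by (rule uA)
      finally show ?thesis using s by (simp add: field_simps)
    qed
    then have "b * (2 * a * u - a\<^sup>2 * s) \<le> b * (A / s)"
      using b by (intro mult_left_mono) auto
    ultimately show ?thesis by (simp add: s_def b_def)
  qed
qed

section \<open>Curves from the identity and the infimum of their lengths\<close>

text \<open>Carrying the velocity \<open>D\<close> and the finite exceptional set \<open>S\<close>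
  explicitly lets a transformed curve be given together with its transformed velocity. Values of
  \<open>D\<close> on \<open>S\<close> do not affect integrals.\<close>

definition G_curve ::
  "real set \<Rightarrow> (real \<Rightarrow> real^3) \<Rightarrow> (real \<Rightarrow> real^3) \<Rightarrow> real^3 \<Rightarrow> bool" where
  "G_curve S c D p \<longleftrightarrow> finite S \<and> continuous_on {0..1} c
     \<and> (\<forall>t\<in>{0..1} - S. (c has_vector_derivative D t) (at t)) \<and> continuous_on ({0..1} - S) D
     \<and> c 0 = 0 \<and> c 1 = p"

abbreviation G_dist :: "real^3 \<Rightarrow> real" where
  "G_dist \<equiv> riemannian_dist G_metric G_one"

abbreviation G_paths :: "real^3 \<Rightarrow> (real \<Rightarrow> real^3) set" where
  "G_paths p \<equiv> {c. valid_path c \<and> pathstart c = G_one \<and> pathfinish c = p \<and>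
     riemannian_speed G_metric c integrable_on {0..1}}"

lemma G_dist_eq_Inf: "G_dist p = Inf (riemannian_length G_metric ` G_paths p)"
  by (simp add: riemannian_dist_def setcompr_eq_image)

lemma riemannian_length_G_nonneg: "0 \<le> riemannian_length G_metric c"
proof (cases "riemannian_speed G_metric c integrable_on {0..1}")
  case True
  then show ?thesis
    unfolding riemannian_length_def riemannian_speed_def
    by (intro integral_nonneg) (simp_all add: G_norm_def [symmetric])
qed (simp add: riemannian_length_def not_integrable_integral)

lemma bdd_below_G_lengths: "bdd_below (riemannian_length G_metric ` A)"
  by (rule bdd_belowI [of _ 0]) (auto simp: riemannian_length_G_nonneg)

text \<open>The speed is continuous off a finite set, hence measurable, so domination by an
  integrable \<open>g\<close> makes it integrable. Thus any integrable bound on the speed makes the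
  curve admissible in the infimum and bounds its length.\<close>

lemma G_curve_path:
  assumes c: "G_curve S c D p" and g: "g integrable_on {0..1}"
    and le: "\<And>t. t \<in> {0..1} \<Longrightarrow> G_norm (c t) (D t) \<le> g t"
  shows "c \<in> G_paths p" "riemannian_length G_metric c \<le> integral {0..1} g"
proof -
  have S: "finite S" and cont: "continuous_on {0..1} c"
    and der: "\<And>t. t \<in> {0..1} - S \<Longrightarrow> (c has_vector_derivative D t) (at t)"
    and contD: "continuous_on ({0..1} - S) D" and ends: "c 0 = 0" "c 1 = p"
    using c by (auto simp: G_curve_def)
  have sp: "riemannian_speed G_metric c t = G_norm (c t) (D t)" if "t \<in> {0..1} - S" for t
    by (simp add: riemannian_speed_def G_norm_def vector_derivative_at [OF der [OF that]])
  have neg: "negligible S" by (rule negligible_finite [OF S])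
  have "continuous_on ({0..1} - S) (\<lambda>t. G_norm (c t) (D t))"
    by (intro continuous_on_G_norm contD continuous_on_subset [OF cont]) auto
  moreover have meas: "{0..1::real} - S \<in> sets lebesgue"
    using S by (intro sets.Diff) (auto simp: finite_imp_closed)
  ultimately have "(\<lambda>t. G_norm (c t) (D t)) \<in> borel_measurable (lebesgue_on ({0..1} - S))"
    by (rule continuous_imp_measurable_on_sets_lebesgue)
  moreover have "g integrable_on ({0..1} - S)"
    using g by (rule integrable_spike_set) (auto intro: negligible_subset [OF neg])
  ultimately have "(\<lambda>t. G_norm (c t) (D t)) integrable_on ({0..1} - S)"
    by (rule measurable_bounded_by_integrable_imp_integrable) (use le meas in auto)
  then have int: "(\<lambda>t. G_norm (c t) (D t)) integrable_on {0..1}"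
    by (rule integrable_spike_set) (auto intro: negligible_subset [OF neg])
  have int': "riemannian_speed G_metric c integrable_on {0..1}"
    by (rule integrable_spike [OF int neg sp])
  have eq: "integral {0..1} (riemannian_speed G_metric c) = integral {0..1} (\<lambda>t. G_norm (c t) (D t))"
    by (rule integral_spike [OF neg]) (simp add: sp)
  show "riemannian_length G_metric c \<le> integral {0..1} g"
    unfolding riemannian_length_def eq by (rule integral_le [OF int g le])
  have "valid_path c"
    unfolding valid_path_def piecewise_C1_differentiable_on_def C1_differentiable_on_def
    using cont S der contD by blast
  with ends int' show "c \<in> G_paths p"
    by (simp add: pathstart_def pathfinish_def G_one_def)
qed

lemma G_dist_le:
  assumes "G_curve S c D p" "g integrable_on {0..1}"
    and "\<And>t. t \<in> {0..1} \<Longrightarrow> G_norm (c t) (D t) \<le> g t"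
  shows "G_dist p \<le> integral {0..1} g"
  unfolding G_dist_eq_Inf using G_curve_path [OF assms]
  by (intro cInf_lower2 [OF imageI]) (auto simp: bdd_below_G_lengths)

lemma G_paths_nonempty: "G_paths p \<noteq> {}"
proof -
  have "G_curve {} (\<lambda>t. t *\<^sub>R p) (\<lambda>t. p) p"
    unfolding G_curve_def by (auto intro!: continuous_intros derivative_eq_intros)
  moreover have "(\<lambda>t::real. exp \<bar>p$3\<bar> * norm p) integrable_on {0..1}"
    by (rule integrable_const_ivl)
  ultimately have "(\<lambda>t. t *\<^sub>R p) \<in> G_paths p"
    by (rule G_curve_path)
      (auto intro!: G_norm_le_norm simp: abs_mult mult_left_le_one_le)
  then show ?thesis by blast
qed

lemma G_dist_lessE:
  assumes "G_dist p < L"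
  obtains S c D where "G_curve S c D p" "(\<lambda>t. G_norm (c t) (D t)) integrable_on {0..1}"
    "integral {0..1} (\<lambda>t. G_norm (c t) (D t)) < L"
proof -
  have "Inf (riemannian_length G_metric ` G_paths p) < L"
    using assms by (simp only: G_dist_eq_Inf)
  then obtain c where c: "c \<in> G_paths p" and L: "riemannian_length G_metric c < L"
    using cInf_lessD G_paths_nonempty by (metis (no_types, lifting) image_iff image_is_empty)
  define D where "D = (\<lambda>t. vector_derivative c (at t))"
  have sp: "riemannian_speed G_metric c = (\<lambda>t. G_norm (c t) (D t))"
    by (simp add: fun_eq_iff riemannian_speed_def G_norm_def D_def)
  obtain S where S: "finite S" "c C1_differentiable_on ({0..1} - S)"
    and "continuous_on {0..1} c"
    using c by (auto simp: valid_path_def piecewise_C1_differentiable_on_def)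
  then have "G_curve S c D p"
    using c unfolding G_curve_def D_def C1_differentiable_on_eq
    by (auto simp: pathstart_def pathfinish_def G_one_def vector_derivative_works)
  moreover have "(\<lambda>t. G_norm (c t) (D t)) integrable_on {0..1}"
    using c by (simp add: sp)
  moreover have "integral {0..1} (\<lambda>t. G_norm (c t) (D t)) < L"
    using L by (simp only: riemannian_length_def sp)
  ultimately show ?thesis by (rule that)
qed

section \<open>Height and norm bounds, continuity of the distance\<close>

lemma G_curve_has_integral:
  assumes "G_curve S c D p" "0 \<le> t" "t \<le> 1"
  shows "(D has_integral c t) {0..t}"
proof -
  have "(D has_integral (c t - c 0)) {0..t}"
    using assms unfolding G_curve_def
    by (intro fundamental_theorem_of_calculus_strong [of S])
      (auto intro: continuous_on_subset)
  then show ?thesis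
    using assms(1) by (simp add: G_curve_def)
qed

text \<open>The vertical speed is at most the speed. Hence a curve of length below \<open>L\<close>
  stays in the slab of height \<open>L\<close>, where Riemannian and Euclidean norms differ by a
  factor of at most \<open>exp L\<close>.\<close>

lemma G_curve_height:
  assumes c: "G_curve S c D p" and int: "(\<lambda>t. G_norm (c t) (D t)) integrable_on {0..1}"
    and t: "t \<in> {0..1}"
  shows "\<bar>c t $ 3\<bar> \<le> integral {0..1} (\<lambda>t. G_norm (c t) (D t))"
proof -
  have "((\<lambda>s. D s $ 3) has_integral c t $ 3) {0..t}"
    using has_integral_linear [OF G_curve_has_integral [OF c] bounded_linear_vec_nth] t
    by (simp add: o_def)
  then have D: "(\<lambda>s. D s $ 3) integrable_on {0..t}" "integral {0..t} (\<lambda>s. D s $ 3) = c t $ 3"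
    by (auto simp: has_integral_iff)
  have int_t: "(\<lambda>t. G_norm (c t) (D t)) integrable_on {0..t}"
    by (rule integrable_on_subinterval [OF int]) (use t in auto)
  have "\<bar>c t $ 3\<bar> \<le> integral {0..t} (\<lambda>t. G_norm (c t) (D t))"
    unfolding D(2) [symmetric] real_norm_def [symmetric]
    by (rule integral_norm_bound_integral [OF D(1) int_t]) (simp add: abs_nth_3_le_G_norm)
  also have "\<dots> \<le> integral {0..1} (\<lambda>t. G_norm (c t) (D t))"
    by (rule integral_subset_le [OF _ int_t int]) (use t in auto)
  finally show ?thesis .
qed

lemma G_dist_ge_height: "\<bar>p$3\<bar> \<le> G_dist p"
proof (rule ccontr)
  assume "\<not> ?thesis"
  then have "G_dist p < \<bar>p$3\<bar>" by simp
  then obtain S c D where "G_curve S c D p" "(\<lambda>t. G_norm (c t) (D t)) integrable_on {0..1}"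
    "integral {0..1} (\<lambda>t. G_norm (c t) (D t)) < \<bar>p$3\<bar>"
    by (rule G_dist_lessE)
  then show False
    using G_curve_height [of S c D p 1] by (auto simp: G_curve_def)
qed

lemma G_dist_vertical: "G_dist (vertical p) = \<bar>p$3\<bar>"
proof (rule antisym)
  have "G_curve {} (\<lambda>t. t *\<^sub>R vertical p) (\<lambda>t. vertical p) (vertical p)"
    unfolding G_curve_def by (auto intro!: continuous_intros derivative_eq_intros)
  then have "G_dist (vertical p) \<le> integral {0..1} (\<lambda>t::real. \<bar>p$3\<bar>)"
    by (rule G_dist_le) (auto simp: G_norm_alt)
  then show "G_dist (vertical p) \<le> \<bar>p$3\<bar>" by simp
  show "\<bar>p$3\<bar> \<le> G_dist (vertical p)"
    using G_dist_ge_height [of "vertical p"] by simp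
qed

text \<open>Integrating the velocity of a curve of length below \<open>L\<close> bounds its
  Euclidean displacement. This makes geodesic spheres bounded and the distance unbounded along
  horizontal rays.\<close>

lemma norm_le_G_dist:
  assumes L: "G_dist p < L"
  shows "norm p \<le> exp L * L"
proof -
  obtain S c D where c: "G_curve S c D p" and int: "(\<lambda>t. G_norm (c t) (D t)) integrable_on {0..1}"
    and I: "integral {0..1} (\<lambda>t. G_norm (c t) (D t)) < L"
    using L by (rule G_dist_lessE)
  have D: "(D has_integral p) {0..1}"
    using G_curve_has_integral [OF c, of 1] c by (simp add: G_curve_def)
  have "norm (D t) \<le> exp L * G_norm (c t) (D t)" if "t \<in> {0..1}" for t
  proof -
    have "exp (- L) * norm (D t) \<le> G_norm (c t) (D t)"
      using G_curve_height [OF c int that] I by (intro norm_le_G_norm) linarith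
    then show ?thesis by (simp add: exp_minus field_simps)
  qed
  then have "norm (integral {0..1} D) \<le> integral {0..1} (\<lambda>t. exp L * G_norm (c t) (D t))"
    using D int by (intro integral_norm_bound_integral integrable_on_cmult_left) auto
  also have "\<dots> = exp L * integral {0..1} (\<lambda>t. G_norm (c t) (D t))" by simp
  also have "\<dots> \<le> exp L * L" using I by simp
  finally show ?thesis using D by (simp add: integral_unique)
qed

text \<open>Adding the drift \<open>t *\<^sub>R (q - p)\<close> to a short curve to \<open>p\<close>
  gives a curve to \<open>q\<close>. The drift changes the height by at most
  \<open>norm (q - p)\<close>, which costs the outer factor, and changes the velocity by
  \<open>q - p\<close>, which costs the added term.\<close>

lemma G_dist_perturb:
  assumes L: "G_dist p < L"
  shows "G_dist q \<le> exp (norm (q - p)) * (L + exp L * norm (q - p))"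
proof -
  obtain S c D where c: "G_curve S c D p" and int: "(\<lambda>t. G_norm (c t) (D t)) integrable_on {0..1}"
    and I: "integral {0..1} (\<lambda>t. G_norm (c t) (D t)) < L"
    using L by (rule G_dist_lessE)
  define h where "h = q - p"
  have curve: "G_curve S (\<lambda>t. c t + t *\<^sub>R h) (\<lambda>t. D t + h) q"
    using c unfolding G_curve_def h_def
    by (auto intro!: continuous_intros derivative_eq_intros)
  have "G_norm (c t + t *\<^sub>R h) (D t + h) \<le> exp (norm h) * (G_norm (c t) (D t) + exp L * norm h)"
    if t: "t \<in> {0..1}" for t
  proof -
    have "\<bar>h$3\<bar> \<le> norm h" by (rule component_le_norm_cart)
    then have "\<bar>(c t + t *\<^sub>R h)$3 - c t $ 3\<bar> \<le> norm h"
      using t mult_left_le_one_le [of "\<bar>h$3\<bar>" t] by (simp add: abs_mult)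
    then have "G_norm (c t + t *\<^sub>R h) (D t + h) \<le> exp (norm h) * G_norm (c t) (D t + h)"
      by (rule G_norm_change_base)
    also have "G_norm (c t) (D t + h) \<le> G_norm (c t) (D t) + G_norm (c t) h"
      by (rule G_norm_triangle)
    also have "G_norm (c t) h \<le> exp L * norm h"
      using G_curve_height [OF c int t] I by (intro G_norm_le_norm) linarith
    finally show ?thesis by simp
  qed
  moreover have "(\<lambda>t. exp (norm h) * (G_norm (c t) (D t) + exp L * norm h)) integrable_on {0..1}"
    using integrable_cmul [OF integrable_add [OF int integrable_const_ivl], of "exp (norm h)"] by simp
  ultimately have "G_dist q \<le> integral {0..1} (\<lambda>t. exp (norm h) * (G_norm (c t) (D t) + exp L * norm h))"
    by (intro G_dist_le [OF curve])
  also have "\<dots> = exp (norm h) * (integral {0..1} (\<lambda>t. G_norm (c t) (D t)) + exp L * norm h)"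
    using int by (simp add: integral_add integrable_const_ivl)
  also have "\<dots> \<le> exp (norm h) * (L + exp L * norm h)"
    using I by simp
  finally show ?thesis unfolding h_def .
qed

lemma G_dist_perturb':
  assumes "G_dist p < M"
  shows "G_dist q \<le> exp (norm (q - p)) * (G_dist p + exp M * norm (q - p))"
proof -
  let ?n = "norm (q - p)"
  \<comment> \<open>Replacing \<open>exp L\<close> by \<open>exp M\<close> makes the bound affine in
    \<open>L\<close>, so it can be solved for \<open>L\<close>; then \<open>L\<close> decreases to
    \<open>G_dist p\<close>.\<close>
  have "G_dist q / exp ?n - exp M * ?n \<le> L" if "G_dist p < L" "L < M" for L
  proof -
    have "G_dist q \<le> exp ?n * (L + exp L * ?n)" using that by (intro G_dist_perturb)
    also have "\<dots> \<le> exp ?n * (L + exp M * ?n)"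
      using that by (intro mult_left_mono add_left_mono mult_right_mono) auto
    finally show ?thesis by (simp add: field_simps)
  qed
  then have "G_dist q / exp ?n - exp M * ?n \<le> G_dist p"
    by (rule dense_ge_bounded [OF assms])
  then show ?thesis by (simp add: field_simps)
qed

lemma continuous_on_G_dist: "continuous_on A G_dist"
proof (rule continuous_at_imp_continuous_on, rule ballI)
  fix p :: "real^3"
  let ?n = "\<lambda>q. norm (q - p)"
  \<comment> \<open>A strict upper bound for \<open>G_dist\<close> on the open unit ball around
    \<open>p\<close>, so that the perturbation estimate also applies from nearby \<open>q\<close>
    back to \<open>p\<close> with a constant that does not depend on \<open>q\<close>.\<close>
  define M where "M = exp 1 * (G_dist p + 1 + exp (G_dist p + 1)) + 1"
  have n: "?n \<midarrow>p\<rightarrow> norm (p - p)" by (intro tendsto_intros)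
  have lower: "exp (- ?n q) * G_dist p - exp M * ?n q \<le> G_dist q" if "?n q < 1" for q
  proof -
    have p0: "0 \<le> G_dist p" using G_dist_ge_height [of p] by linarith
    have "G_dist q \<le> exp (?n q) * (G_dist p + 1 + exp (G_dist p + 1) * ?n q)"
      by (rule G_dist_perturb) simp
    also have "\<dots> \<le> exp 1 * (G_dist p + 1 + exp (G_dist p + 1) * 1)"
      using that p0 by (intro mult_mono add_left_mono mult_left_mono) auto
    also have "\<dots> < M" by (simp add: M_def)
    finally have "G_dist p \<le> exp (norm (p - q)) * (G_dist q + exp M * norm (p - q))"
      by (rule G_dist_perturb')
    then show ?thesis by (simp add: norm_minus_commute exp_minus field_simps)
  qed
  show "isCont G_dist p"
    unfolding isCont_def
  proof (rule tendsto_sandwich)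
    show "\<forall>\<^sub>F q in at p. exp (- ?n q) * G_dist p - exp M * ?n q \<le> G_dist q"
      using order_tendstoD(2) [OF n, of 1] by (auto elim: eventually_mono simp: lower)
    show "\<forall>\<^sub>F q in at p. G_dist q \<le> exp (?n q) * (G_dist p + exp (G_dist p + 1) * ?n q)"
      by (intro always_eventually allI G_dist_perturb') simp
    have "(\<lambda>q. exp (- ?n q) * G_dist p - exp M * ?n q)
        \<midarrow>p\<rightarrow> exp (- norm (p - p)) * G_dist p - exp M * norm (p - p)"
      by (intro tendsto_intros)
    then show "(\<lambda>q. exp (- ?n q) * G_dist p - exp M * ?n q) \<midarrow>p\<rightarrow> G_dist p" by simp
    have "(\<lambda>q. exp (?n q) * (G_dist p + exp (G_dist p + 1) * ?n q))
        \<midarrow>p\<rightarrow> exp (norm (p - p)) * (G_dist p + exp (G_dist p + 1) * norm (p - p))"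
      by (intro tendsto_intros)
    then show "(\<lambda>q. exp (?n q) * (G_dist p + exp (G_dist p + 1) * ?n q)) \<midarrow>p\<rightarrow> G_dist p" by simp
  qed
qed

section \<open>Strict growth of the distance along horizontal rays\<close>

text \<open>Since no minimising curve is at hand, shortening each curve strictly would only give a
  weak inequality for the infimum. The saving is therefore bounded below by a
  \<open>\<delta>\<close> chosen before the curve.\<close>

lemma G_dist_scale_horizontal_less:
  assumes k: "0 \<le> k" "k < 1" and p: "horizontal p \<noteq> 0"
  shows "G_dist (scale_horizontal k p) < G_dist p"
proof -
  define L \<rho> m b where "L = G_dist p + 1" and "\<rho> = norm (horizontal p)" and "m = exp (- L)"
    and "b = (1 - k\<^sup>2) / 2"
  \<comment> \<open>This \<open>a\<close> maximises \<open>2 * a * (m * \<rho>) - a^2 * L\<close>,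
    with maximum \<open>m^2 * \<rho>^2 / L\<close>; multiplied by \<open>b\<close> it is the
    guaranteed saving \<open>\<delta>\<close>.\<close>
  define a where "a = m * \<rho> / L"
  define \<delta> where "\<delta> = b * (m\<^sup>2 * \<rho>\<^sup>2 / L)"
  have L: "0 < L" using G_dist_ge_height [of p] by (simp add: L_def)
  have \<rho>: "0 < \<rho>" using p by (simp add: \<rho>_def)
  have m: "0 < m" by (simp add: m_def)
  have "k\<^sup>2 < 1" using k by (simp add: power_less_one_iff)
  then have b: "0 < b" by (simp add: b_def)
  have \<delta>: "0 < \<delta>" using L \<rho> m b by (simp add: \<delta>_def)
  \<comment> \<open>The 1 keeps the length of the chosen curve below \<open>L\<close>; the
    \<open>\<delta>\<close> makes the saving exceed the excess of its length over the
    distance.\<close>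
  have "G_dist p < G_dist p + min 1 \<delta>" using \<delta> by simp
  then obtain S c D where c: "G_curve S c D p" and int: "(\<lambda>t. G_norm (c t) (D t)) integrable_on {0..1}"
    and I: "integral {0..1} (\<lambda>t. G_norm (c t) (D t)) < G_dist p + min 1 \<delta>"
    by (rule G_dist_lessE)
  let ?I = "integral {0..1} (\<lambda>t. G_norm (c t) (D t))"
  have IL: "?I \<le> L" using I by (simp add: L_def)
  \<comment> \<open>The velocity component along the horizontal direction of \<open>p\<close>. Its
    integral is \<open>\<rho>\<close> for every curve to \<open>p\<close>, while
    \<open>m * u\<close> is bounded in absolute value by the horizontal Riemannian speed.\<close>
  define u where "u = (\<lambda>t. horizontal p \<bullet> D t / \<rho>)"
  have inn: "horizontal p \<bullet> v = horizontal p \<bullet> horizontal v" for v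
    by (simp add: inner_3)
  have D: "(D has_integral p) {0..1}"
    using G_curve_has_integral [OF c, of 1] c by (simp add: G_curve_def)
  have "horizontal p \<bullet> p = \<rho>\<^sup>2"
    by (subst inn) (simp add: \<rho>_def power2_norm_eq_inner)
  moreover have "(u has_integral (horizontal p \<bullet> p / \<rho>)) {0..1}"
    unfolding u_def
    using has_integral_linear [OF D bounded_linear_inner_right, of "horizontal p"]
    by (auto intro!: has_integral_divide simp: o_def)
  ultimately have u: "(u has_integral \<rho>) {0..1}"
    using \<rho> by (simp add: power2_eq_square)
  have curve: "G_curve S (\<lambda>t. scale_horizontal k (c t)) (\<lambda>t. scale_horizontal k (D t)) (scale_horizontal k p)"
    using c unfolding G_curve_def
    by (auto intro!: bounded_linear.continuous_on [OF bounded_linear_scale_horizontal]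
        bounded_linear.has_vector_derivative [OF bounded_linear_scale_horizontal]
        simp: vec_eq_iff forall_3)
  define g where "g = (\<lambda>t. G_norm (c t) (D t) - b * (2 * a * (m * u t) - a\<^sup>2 * G_norm (c t) (D t)))"
  have "G_norm (scale_horizontal k (c t)) (scale_horizontal k (D t)) \<le> g t" if t: "t \<in> {0..1}" for t
  proof -
    have "\<bar>u t\<bar> \<le> norm (horizontal (D t))"
      using Cauchy_Schwarz_ineq2 [of "horizontal p" "horizontal (D t)"] \<rho>
      by (simp add: u_def inn [of "D t"] \<rho>_def field_simps)
    then have "\<bar>m * u t\<bar> \<le> m * norm (horizontal (D t))"
      using m by (simp add: abs_mult)
    also have "\<dots> \<le> G_norm (c t) (horizontal (D t))"
      unfolding m_def using G_curve_height [OF c int t] IL by (intro norm_le_G_norm) linarith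
    finally show ?thesis
      unfolding g_def b_def by (rule G_norm_scale_horizontal_le [OF k])
  qed
  moreover have "(g has_integral (?I - b * (2 * a * (m * \<rho>) - a\<^sup>2 * ?I))) {0..1}"
    unfolding g_def
    by (intro has_integral_diff has_integral_mult_right u integrable_integral int)
  ultimately have "G_dist (scale_horizontal k p) \<le> ?I - b * (2 * a * (m * \<rho>) - a\<^sup>2 * ?I)"
    using G_dist_le [OF curve, of g] by (auto simp: has_integral_iff)
  also have "\<dots> \<le> ?I - \<delta>"
  proof -
    have "a\<^sup>2 * ?I \<le> a\<^sup>2 * L" using IL by (simp add: mult_left_mono)
    moreover have "2 * a * (m * \<rho>) - a\<^sup>2 * L = m\<^sup>2 * \<rho>\<^sup>2 / L"
      using L by (simp add: a_def power2_eq_square field_simps)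
    ultimately have "b * (m\<^sup>2 * \<rho>\<^sup>2 / L) \<le> b * (2 * a * (m * \<rho>) - a\<^sup>2 * ?I)"
      using b by (intro mult_left_mono) linarith+
    then show ?thesis by (simp add: \<delta>_def)
  qed
  also have "\<dots> < G_dist p" using I by simp
  finally show ?thesis .
qed

lemma G_dist_gt_height: "horizontal p \<noteq> 0 \<Longrightarrow> \<bar>p$3\<bar> < G_dist p"
  using G_dist_scale_horizontal_less [of 0 p] by (simp add: scale_horizontal_def G_dist_vertical)

lemma G_dist_eq_height_iff: "G_dist p = \<bar>p$3\<bar> \<longleftrightarrow> horizontal p = 0"
  by (metis G_dist_gt_height G_dist_vertical horizontal_eq_0_iff less_irrefl)

section \<open>Rescaling the geodesic sphere to the unit sphere\<close>

definition sphere_map :: "real \<Rightarrow> real^3 \<Rightarrow> real^3" where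
  "sphere_map r p = (sqrt (1 - (p$3 / r)\<^sup>2) / norm (horizontal p)) *\<^sub>R horizontal p + (1 / r) *\<^sub>R vertical p"

lemma sphere_map_nth_3: "sphere_map r p $ 3 = p$3 / r"
  by (simp add: sphere_map_def)

lemma horizontal_sphere_map:
  "horizontal (sphere_map r p) = sqrt (1 - (p$3 / r)\<^sup>2) *\<^sub>R sgn (horizontal p)"
  by (simp add: sphere_map_def vec_eq_iff forall_3 sgn_div_norm divide_inverse)

context
  fixes r :: real
  assumes r: "0 < r"
begin

lemma sphere_height: "G_dist p = r \<Longrightarrow> 0 \<le> 1 - (p$3 / r)\<^sup>2"
  using G_dist_ge_height [of p] r by (simp add: abs_square_le_1)

text \<open>Both sides say that the height equals the distance up to sign, which happens only on the
  axis. So the square root and the horizontal part in \<open>sphere_map\<close> vanish together, at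
  the poles.\<close>

lemma sphere_height_eq_0_iff:
  assumes "G_dist p = r"
  shows "1 - (p$3 / r)\<^sup>2 = 0 \<longleftrightarrow> horizontal p = 0"
proof -
  have "1 - (p$3 / r)\<^sup>2 = 0 \<longleftrightarrow> \<bar>p$3\<bar> = r"
    using abs_square_eq_1 [of "p$3 / r"] r by auto
  then show ?thesis using G_dist_eq_height_iff assms by metis
qed

lemma continuous_on_sphere_map: "continuous_on {p. G_dist p = r} (sphere_map r)"
  unfolding continuous_on_def
proof
  fix p assume p: "p \<in> {p. G_dist p = r}"
  let ?F = "at p within {p. G_dist p = r}"
  let ?f = "\<lambda>p. (sqrt (1 - (p$3 / r)\<^sup>2) / norm (horizontal p)) *\<^sub>R horizontal p"
  have h: "(horizontal \<longlongrightarrow> horizontal p) ?F"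
    by (intro bounded_linear.tendsto [OF bounded_linear_horizontal] tendsto_intros)
  have s: "((\<lambda>p. sqrt (1 - (p$3 / r)\<^sup>2)) \<longlongrightarrow> sqrt (1 - (p$3 / r)\<^sup>2)) ?F"
    using r by (intro tendsto_intros) auto
  have "(?f \<longlongrightarrow> ?f p) ?F"
  proof (cases "horizontal p = 0")
    case False
    then show ?thesis by (intro tendsto_intros h s) auto
  next
    case True
    then have "sqrt (1 - (p$3 / r)\<^sup>2) = 0"
      using p sphere_height_eq_0_iff [of p] by simp
    with s have s0: "((\<lambda>p. sqrt (1 - (p$3 / r)\<^sup>2)) \<longlongrightarrow> 0) ?F" by simp
    \<comment> \<open>At a pole the quotient need not converge, but the norm of the whole horizontal
      term is at most the square root, which tends to 0.\<close>
    have "(?f \<longlongrightarrow> 0) ?F"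
    proof (rule Lim_null_comparison [OF _ s0])
      show "\<forall>\<^sub>F p in ?F. norm (?f p) \<le> sqrt (1 - (p$3 / r)\<^sup>2)"
        unfolding eventually_at_filter
      proof (intro always_eventually allI impI)
        fix q assume "q \<in> {p. G_dist p = r}"
        then have "0 \<le> 1 - (q$3 / r)\<^sup>2" by (intro sphere_height) simp
        then show "norm (?f q) \<le> sqrt (1 - (q$3 / r)\<^sup>2)" by simp
      qed
    qed
    with True show ?thesis by simp
  qed
  then show "(sphere_map r \<longlongrightarrow> sphere_map r p) ?F"
    unfolding sphere_map_def
    by (rule tendsto_add) (intro tendsto_intros bounded_linear.tendsto [OF bounded_linear_vertical])
qed

lemma inj_on_sphere_map: "inj_on (sphere_map r) {p. G_dist p = r}"
proof (rule inj_onI)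
  fix p q assume pq: "p \<in> {p. G_dist p = r}" "q \<in> {p. G_dist p = r}"
    and eq: "sphere_map r p = sphere_map r q"
  have z: "p$3 = q$3"
    using arg_cong [OF eq, of "\<lambda>v. v$3"] r by (simp add: sphere_map_nth_3)
  then have hor: "horizontal p = 0 \<longleftrightarrow> horizontal q = 0"
    using sphere_height_eq_0_iff pq by (metis mem_Collect_eq)
  have ver: "vertical p = vertical q" using z by (simp add: vertical_def)
  \<comment> \<open>Two points with equal height and horizontal direction differ by a horizontal
    scaling, so the one nearer the axis is strictly closer to the identity. Fresh \<open>p\<close>
    and \<open>q\<close> allow use in both orders.\<close>
  have strict: False if ne: "horizontal q \<noteq> 0" and less: "norm (horizontal p) < norm (horizontal q)"
    and sgn: "sgn (horizontal p) = sgn (horizontal q)" and ver: "vertical p = vertical q"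
    and dist: "G_dist p = G_dist q" for p q
  proof -
    have "horizontal p = norm (horizontal p) *\<^sub>R sgn (horizontal q)"
      unfolding sgn [symmetric]
      by (cases "horizontal p = 0") (simp_all add: sgn_div_norm)
    then have "p = scale_horizontal (norm (horizontal p) / norm (horizontal q)) q"
      using horizontal_vertical [of p] ver
      by (simp add: scale_horizontal_def sgn_div_norm divide_inverse)
    moreover have "G_dist (scale_horizontal (norm (horizontal p) / norm (horizontal q)) q) < G_dist q"
      using ne less by (intro G_dist_scale_horizontal_less) auto
    ultimately show False using dist by simp
  qed
  have "horizontal p = horizontal q"
  proof (cases "horizontal p = 0")
    case True
    then show ?thesis using hor by simp
  next
    case False
    then have "sqrt (1 - (p$3 / r)\<^sup>2) \<noteq> 0"
      using pq sphere_height_eq_0_iff [of p] by simp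
    then have sgn: "sgn (horizontal p) = sgn (horizontal q)"
      using arg_cong [OF eq, of horizontal] z by (simp add: horizontal_sphere_map)
    have "norm (horizontal p) = norm (horizontal q)"
      using strict [of p q] strict [of q p] False hor sgn ver pq
      by (metis (mono_tags, lifting) linorder_neqE_linordered_idom mem_Collect_eq)
    then show ?thesis
      using sgn False hor by (auto simp: sgn_div_norm)
  qed
  then show "p = q" using ver by (metis horizontal_vertical)
qed

text \<open>Intermediate value theorem along the ray: the distance is below \<open>r\<close> on the
  axis and at least \<open>r\<close> far out.\<close>

lemma ex_scale_horizontal_on_sphere:
  assumes "\<bar>p$3\<bar> < r" and "horizontal p \<noteq> 0"
  obtains t where "0 < t" "G_dist (scale_horizontal t p) = r"
proof -
  \<comment> \<open>Chosen so that the scaled horizontal part has norm one more than the bound of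
    \<open>norm_le_G_dist\<close> for \<open>L = r + 1\<close>.\<close>
  define T where "T = (exp (r + 1) * (r + 1) + 1) / norm (horizontal p)"
  have T: "0 < T" using r assms by (simp add: T_def add_pos_pos)
  have "r \<le> G_dist (scale_horizontal T p)"
  proof (rule ccontr)
    assume "\<not> ?thesis"
    then have "norm (scale_horizontal T p) \<le> exp (r + 1) * (r + 1)"
      by (intro norm_le_G_dist) simp
    moreover have "T * norm (horizontal p) \<le> norm (scale_horizontal T p)"
      by (rule power2_le_imp_le)
        (use norm_horizontal_vertical [of T p 1 p] in \<open>simp_all add: scale_horizontal_def\<close>)
    moreover have "T * norm (horizontal p) = exp (r + 1) * (r + 1) + 1"
      using assms by (simp add: T_def)
    ultimately show False by simp
  qed
  moreover have G0: "G_dist (scale_horizontal 0 p) < r"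
    using assms by (simp add: scale_horizontal_def G_dist_vertical)
  moreover have "continuous_on {0..T} (\<lambda>t. G_dist (scale_horizontal t p))"
    unfolding scale_horizontal_def
    by (rule continuous_on_compose2 [OF continuous_on_G_dist [of UNIV]]) (auto intro!: continuous_intros)
  ultimately obtain t where t: "0 \<le> t" "G_dist (scale_horizontal t p) = r"
    using IVT' [of "\<lambda>t. G_dist (scale_horizontal t p)" 0 r T] T by auto
  with G0 have "t \<noteq> 0" by auto
  with t have "0 < t" by simp
  then show ?thesis using t(2) by (rule that)
qed

lemma sphere_map_image: "sphere_map r ` {p. G_dist p = r} = sphere 0 1"
proof (intro equalityI subsetI)
  fix q assume "q \<in> sphere_map r ` {p. G_dist p = r}"
  then obtain p where p: "G_dist p = r" and q: "q = sphere_map r p" by auto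
  have "(norm (sphere_map r p))\<^sup>2
      = (sqrt (1 - (p$3 / r)\<^sup>2) / norm (horizontal p) * norm (horizontal p))\<^sup>2 + (1 / r * p$3)\<^sup>2"
    unfolding sphere_map_def by (rule norm_horizontal_vertical)
  \<comment> \<open>At a pole the first summand is 0 because the horizontal norm is 0, and the
    second is already 1; elsewhere the horizontal norm cancels.\<close>
  then have "(norm (sphere_map r p))\<^sup>2 = 1"
    using sphere_height_eq_0_iff [OF p] sphere_height [OF p]
    by (cases "horizontal p = 0") simp_all
  then have "norm (sphere_map r p) = 1"
    using norm_ge_zero [of "sphere_map r p"] by (auto simp: power2_eq_1_iff)
  then show "q \<in> sphere 0 1" using q by simp
next
  fix q :: "real^3" assume "q \<in> sphere 0 1"
  then have q: "(norm (horizontal q))\<^sup>2 + (q$3)\<^sup>2 = 1"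
    using norm_horizontal_vertical [of 1 q 1 q] by (simp add: horizontal_vertical)
  \<comment> \<open>The height is already that of the preimage and the horizontal direction is
    right. At a pole \<open>p\<close> itself is the preimage; otherwise its horizontal length is
    adjusted to reach the sphere, and \<open>sphere_map\<close> undoes this adjustment.\<close>
  define p where "p = horizontal q + r *\<^sub>R vertical q"
  have hp: "horizontal p = horizontal q" and zp: "p$3 = r * q$3" and vp: "vertical p = r *\<^sub>R vertical q"
    by (simp_all add: p_def vec_eq_iff forall_3)
  show "q \<in> sphere_map r ` {p. G_dist p = r}"
  proof (cases "horizontal q = 0")
    case True
    then have "\<bar>q$3\<bar> = 1" using q by (simp add: abs_square_eq_1)
    then have "G_dist p = r"
      using True hp zp r G_dist_eq_height_iff [of p] by (simp add: abs_mult)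
    moreover have "sphere_map r p = q"
      using True hp vp r horizontal_vertical [of q] by (simp add: sphere_map_def)
    ultimately show ?thesis by blast
  next
    case False
    then have "0 < (norm (horizontal q))\<^sup>2" by simp
    then have "(q$3)\<^sup>2 < 1" using q by linarith
    then have "\<bar>q$3\<bar> < 1" by (simp add: abs_square_less_1)
    then have "\<bar>p$3\<bar> < r" using zp r by (simp add: abs_mult)
    then obtain t where t: "0 < t" "G_dist (scale_horizontal t p) = r"
      using ex_scale_horizontal_on_sphere False hp by metis
    have "horizontal (scale_horizontal t p) = t *\<^sub>R horizontal q"
      "vertical (scale_horizontal t p) = r *\<^sub>R vertical q"
      by (simp_all add: vec_eq_iff forall_3 hp [symmetric] zp)
    moreover have "sqrt (1 - (q$3)\<^sup>2) = norm (horizontal q)"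
      using q by (simp add: real_sqrt_unique)
    ultimately have "sphere_map r (scale_horizontal t p) = q"
      using t r zp False horizontal_vertical [of q] by (simp add: sphere_map_def)
    then show ?thesis using t by blast
  qed
qed

lemma compact_G_sphere: "compact {p. G_dist p = r}"
  unfolding compact_eq_bounded_closed
proof
  show "bounded {p. G_dist p = r}"
    by (rule boundedI) (auto intro!: norm_le_G_dist [of _ "r + 1"])
  have "closed (G_dist -` {r})"
    by (rule continuous_closed_vimage)
      (use continuous_on_G_dist [of UNIV] in \<open>simp_all add: continuous_on_eq_continuous_at\<close>)
  then show "closed {p. G_dist p = r}" by (simp add: vimage_def)
qed

end

theorem corollary11:
  fixes r :: real
  assumes "r > 0"
  shows "riemannian_sphere G_metric G_one r homeomorphic sphere (0 :: real^3) 1"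
  unfolding riemannian_sphere_def
  using compact_G_sphere [OF assms] continuous_on_sphere_map [OF assms]
    sphere_map_image [OF assms] inj_on_sphere_map [OF assms]
  by (rule homeomorphic_compact)

end
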